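(* Assume the Continuum Hypothesis. Then there is a Menger-bounded subgroup $G$ of $\mathbb{Z}^{\mathbb{N}}$ such that $G^2$ is not Menger-bounded.
   Context: $\mathbb{Z}^{\mathbb{N}}$ is the Baer-Specker group: the abelian group of all functions $\mathbb{N}\to\mathbb{Z}$ with coordinate-wise addition and the product topology ($\mathbb{Z}$ discrete). Subgroups carry the subspace topology. $G^2=G\times G$ is the direct product with the product topology. A topological group $(H,\cdot)$ is Menger-bounded if for each sequence $(U_n)_{n\in\mathbb{N}}$ of neighborhoods of the unit of $H$ there exist finite sets $F_n\subseteq H$, $n\in\mathbb{N}$, such that $H=\bigcup_n F_n\cdot U_n$, where $A\cdot B=\{a\cdot b: a\in A, b\in B\}$. *)

theory Defs
  imports "HOL-Analysis.Analysis" "HOL-Algebra.Coset" "HOL-Library.Equipollence"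
begin

definition continuum_hypothesis :: bool where
  "continuum_hypothesis \<longleftrightarrow>
     \<not> (\<exists>A :: real set. (UNIV :: nat set) \<prec> A \<and> A \<prec> (UNIV :: real set))"

locale topological_group = group H for H :: "('a, 'b) monoid_scheme" (structure) +
  fixes T :: "'a topology"
  assumes topspace_eq: "topspace T = carrier H"
    and continuous_mult: "continuous_map (prod_topology T T) T (\<lambda>(x, y). x \<otimes> y)"
    and continuous_inv: "continuous_map T T (\<lambda>x. inv x)"

text \<open>Neighborhoods need not be open. The definition is meant for topological groups; the groups it
  is applied to are shown below to be topological groups.\<close>

definition unit_neighborhood :: "('a, 'b) monoid_scheme \<Rightarrow> 'a topology \<Rightarrow> 'a set \<Rightarrow> bool" where
  "unit_neighborhood H T U \<longleftrightarrow>
     U \<subseteq> carrier H \<and> (\<exists>V. openin T V \<and> \<one>\<^bsub>H\<^esub> \<in> V \<and> V \<subseteq> U)"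

definition menger_bounded :: "('a, 'b) monoid_scheme \<Rightarrow> 'a topology \<Rightarrow> bool" where
  "menger_bounded H T \<longleftrightarrow>
     (\<forall>U :: nat \<Rightarrow> 'a set. (\<forall>n. unit_neighborhood H T (U n)) \<longrightarrow>
       (\<exists>F :: nat \<Rightarrow> 'a set. (\<forall>n. finite (F n) \<and> F n \<subseteq> carrier H) \<and>
          carrier H = (\<Union>n. F n <#>\<^bsub>H\<^esub> U n)))"

definition baer_specker :: "(nat \<Rightarrow> int) monoid" where
  "baer_specker = \<lparr>carrier = UNIV, mult = (\<lambda>f g n. f n + g n), one = (\<lambda>n. 0)\<rparr>"

definition baer_specker_topology :: "(nat \<Rightarrow> int) topology" where
  "baer_specker_topology = product_topology (\<lambda>n. discrete_topology UNIV) UNIV"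

lemma group_baer_specker: "group baer_specker"
proof (rule groupI)
  fix x assume "x \<in> carrier baer_specker"
  show "\<exists>y\<in>carrier baer_specker. y \<otimes>\<^bsub>baer_specker\<^esub> x = \<one>\<^bsub>baer_specker\<^esub>"
    by (rule bexI[of _ "\<lambda>n. - x n"]) (auto simp: baer_specker_def)
qed (auto simp: baer_specker_def)

lemma inv_baer_specker: "inv\<^bsub>baer_specker\<^esub> x = (\<lambda>n. - x n)"
  by (rule group.inv_equality[OF group_baer_specker]) (auto simp: baer_specker_def)

lemma topological_group_baer_specker:
  "topological_group baer_specker baer_specker_topology"
proof -
  let ?T = baer_specker_topology
  let ?D = "discrete_topology (UNIV :: int set)"
  have proj: "continuous_map ?T ?D (\<lambda>x. x n)" for n
    unfolding baer_specker_topology_def by (rule continuous_map_product_projection) simp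
  have inv: "continuous_map ?T ?T (\<lambda>x. inv\<^bsub>baer_specker\<^esub> x)"
  proof -
    have "continuous_map ?T ?D (\<lambda>x. - x n)" for n
      using continuous_map_compose[OF proj[of n], of ?D uminus] by (simp add: o_def)
    then show ?thesis
      unfolding inv_baer_specker by (subst (2) baer_specker_topology_def)
        (auto simp: continuous_map_componentwise)
  qed
  have mult: "continuous_map (prod_topology ?T ?T) ?T (\<lambda>(x, y). x \<otimes>\<^bsub>baer_specker\<^esub> y)"
  proof -
    have "continuous_map (prod_topology ?T ?T) (prod_topology ?D ?D) (\<lambda>p. (fst p n, snd p n))" for n
      unfolding continuous_map_pairwise o_def fst_conv snd_conv
      using continuous_map_compose[OF continuous_map_fst proj[of n]]
        continuous_map_compose[OF continuous_map_snd proj[of n]]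
      by (auto simp: o_def)
    then have "continuous_map (prod_topology ?T ?T) ?D
        ((\<lambda>(a, b). a + b) \<circ> (\<lambda>p. (fst p n, snd p n)))" for n
      by (rule continuous_map_compose)
        (simp flip: prod_topology_discrete_topology)
    then show ?thesis
      by (subst (3) baer_specker_topology_def)
        (auto simp: continuous_map_componentwise baer_specker_def o_def case_prod_beta)
  qed
  have "topspace ?T = carrier baer_specker"
    by (simp add: baer_specker_topology_def baer_specker_def)
  then show ?thesis
    using inv mult group_baer_specker
    by (simp add: topological_group_def topological_group_axioms_def)
qed

lemma topological_group_subgroup:
  assumes "topological_group H T" "subgroup G H"
  shows "topological_group (H\<lparr>carrier := G\<rparr>) (subtopology T G)"
proof -
  interpret topological_group H T by fact
  have G: "G \<subseteq> carrier H" "\<And>x y. x \<in> G \<Longrightarrow> y \<in> G \<Longrightarrow> x \<otimes>\<^bsub>H\<^esub> y \<in> G" "\<And>x. x \<in> G \<Longrightarrow> inv\<^bsub>H\<^esub> x \<in> G"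
    using assms(2) by (auto simp: subgroup_def)
  have grp: "group (H\<lparr>carrier := G\<rparr>)"
    using assms(2) is_group by (rule subgroup.subgroup_is_group)
  have inv: "continuous_map (subtopology T G) (subtopology T G) (\<lambda>x. inv\<^bsub>H\<lparr>carrier := G\<rparr>\<^esub> x)"
  proof (rule continuous_map_eq)
    show "continuous_map (subtopology T G) (subtopology T G) (\<lambda>x. inv\<^bsub>H\<^esub> x)"
      using continuous_inv G by (auto simp: continuous_map_in_subtopology continuous_map_from_subtopology)
  qed (use m_inv_consistent[OF assms(2)] in auto)
  have mult: "continuous_map (prod_topology (subtopology T G) (subtopology T G)) (subtopology T G)
      (\<lambda>(x, y). x \<otimes>\<^bsub>H\<^esub> y)"
    using continuous_mult G
    by (auto simp: continuous_map_in_subtopology continuous_map_from_subtopology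
        simp flip: subtopology_Times)
  show ?thesis
    using inv mult grp G topspace_eq
    by (auto simp: topological_group_def topological_group_axioms_def)
qed

lemma topological_group_DirProd:
  assumes "topological_group H S" "topological_group K T"
  shows "topological_group (H \<times>\<times> K) (prod_topology S T)"
proof -
  interpret H: topological_group H S by fact
  interpret K: topological_group K T by fact
  let ?P = "prod_topology S T"
  have grp: "group (H \<times>\<times> K)"
    by (rule DirProd_group) (rule H.is_group K.is_group)+
  have inv: "continuous_map ?P ?P (\<lambda>x. inv\<^bsub>H \<times>\<times> K\<^esub> x)"
  proof (rule continuous_map_eq)
    show "continuous_map ?P ?P (\<lambda>x. (inv\<^bsub>H\<^esub> (fst x), inv\<^bsub>K\<^esub> (snd x)))"
      using continuous_map_compose[OF continuous_map_fst H.continuous_inv]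
        continuous_map_compose[OF continuous_map_snd K.continuous_inv]
      by (auto simp: continuous_map_pairwise o_def)
  qed (auto simp: H.topspace_eq K.topspace_eq inv_DirProd[OF H.is_group K.is_group])
  have 1: "continuous_map (prod_topology ?P ?P) S (\<lambda>p. fst (fst p) \<otimes>\<^bsub>H\<^esub> fst (snd p))"
  proof -
    have "continuous_map (prod_topology ?P ?P) (prod_topology S S) (\<lambda>p. (fst (fst p), fst (snd p)))"
      using continuous_map_compose[OF continuous_map_fst continuous_map_fst]
        continuous_map_compose[OF continuous_map_snd continuous_map_fst]
      by (auto simp: continuous_map_pairwise o_def)
    from continuous_map_compose[OF this H.continuous_mult] show ?thesis by (simp add: o_def)
  qed
  have 2: "continuous_map (prod_topology ?P ?P) T (\<lambda>p. snd (fst p) \<otimes>\<^bsub>K\<^esub> snd (snd p))"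
  proof -
    have "continuous_map (prod_topology ?P ?P) (prod_topology T T) (\<lambda>p. (snd (fst p), snd (snd p)))"
      using continuous_map_compose[OF continuous_map_fst continuous_map_snd]
        continuous_map_compose[OF continuous_map_snd continuous_map_snd]
      by (auto simp: continuous_map_pairwise o_def)
    from continuous_map_compose[OF this K.continuous_mult] show ?thesis by (simp add: o_def)
  qed
  have mult: "continuous_map (prod_topology ?P ?P) ?P (\<lambda>(x, y). x \<otimes>\<^bsub>H \<times>\<times> K\<^esub> y)"
    using 1 2 by (simp add: continuous_map_pairwise o_def DirProd_def case_prod_beta)
  show ?thesis
    using inv mult grp H.topspace_eq K.topspace_eq
    by (simp add: topological_group_def topological_group_axioms_def)
qed

end

theory Submission
  imports Defs
begin

text \<open>A subgroup \<open>G\<close> of the Baer-Specker group is Menger-bounded iff for every \<open>h\<close> there is a single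
  \<open>p\<close> such that each \<open>g \<in> G\<close> satisfies \<open>\<bar>g i\<bar> \<le> p n\<close> for all \<open>i < h n\<close>, for at least one \<open>n\<close>; its
  square is not Menger-bounded as soon as for every \<open>f\<close> there are \<open>x, y \<in> G\<close> with
  \<open>f n < max \<bar>x n\<bar> \<bar>y n\<bar>\<close> for all \<open>n\<close>. Under the Continuum Hypothesis all functions \<open>h\<close> can be listed
  with countable initial segments. At stage \<open>h\<close> one fixes a bound \<open>p\<close> for the countable group
  generated so far and then adjoins a pair \<open>x, y\<close> exceeding \<open>h\<close>, whose integer combinations, also with
  elements of the old group, still obey all the countably many bounds fixed so far. Although \<open>x\<close> and
  \<open>y\<close> are never small simultaneously, each single combination \<open>a x + b y\<close> can be made to vanish on a long
  block of coordinates.\<close>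

section \<open>A well-order with countable initial segments\<close>

text \<open>The strict part of the cardinal order on all functions works: its proper initial
  segments are smaller than the whole set, which embeds into the reals, so the Continuum Hypothesis
  leaves them no uncountable size.\<close>

lemma continuum_hypothesis_wf_order:
  assumes "continuum_hypothesis"
  obtains R :: "(nat \<Rightarrow> nat) rel"
  where "wf R" "trans R" "total R" "\<And>a. countable {b. (b, a) \<in> R}"
proof -
  define r where "r = card_of (UNIV :: (nat \<Rightarrow> nat) set)"
  have card: "Card_order r"
    unfolding r_def by (rule card_of_Card_order)
  have field: "Field r = UNIV"
    by (simp add: r_def Field_card_of)
  have wo: "Well_order r"
    using card by (simp add: card_order_on_def)
  have lin: "linear_order_on (Field r) r" and "wf (r - Id)"
    using wo by (auto simp: well_order_on_def)
  moreover have "trans (r - Id)"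
    using lin by (auto simp: order_on_defs intro: trans_diff_Id)
  moreover have "total (r - Id)"
    using lin field by (auto simp: order_on_defs total_on_def)
  moreover have "countable {b. (b, a) \<in> r - Id}" for a
  proof -
    let ?S = "{b. (b, a) \<in> r - Id}"
    \<comment> \<open>A function is sent to its graph, coded as a set of naturals.\<close>
    have reals: "(UNIV :: (nat \<Rightarrow> nat) set) \<lesssim> (UNIV :: real set)"
    proof -
      have "inj (\<lambda>f :: nat \<Rightarrow> nat. prod_encode ` {(n, f n) | n. True})"
      proof (rule injI)
        fix f g :: "nat \<Rightarrow> nat"
        assume "prod_encode ` {(n, f n) | n. True} = prod_encode ` {(n, g n) | n. True}"
        then have "{(n, f n) | n. True} = {(n, g n) | n. True}"
          by (simp add: inj_image_eq_iff[OF inj_prod_encode])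
        then show "f = g" by blast
      qed
      then have "(UNIV :: (nat \<Rightarrow> nat) set) \<lesssim> (UNIV :: nat set set)"
        unfolding lepoll_def by blast
      then show ?thesis
        using nat_sets_eqpoll_reals lepoll_trans2 by blast
    qed
    then obtain j :: "(nat \<Rightarrow> nat) \<Rightarrow> real" where j: "inj j"
      unfolding lepoll_def by blast
    have eq: "j ` ?S \<approx> ?S"
      by (rule inj_on_image_eqpoll_self) (use j in \<open>auto simp: inj_on_def\<close>)
    have "ordLess2 (card_of ?S) r"
      using card_of_underS[OF card, of a] field by (simp add: underS_def conj_commute)
    then have "\<not> (UNIV :: (nat \<Rightarrow> nat) set) \<lesssim> ?S"
      by (auto simp: r_def lepoll_def card_of_ordLeq not_ordLess_ordLeq)
    then have "\<not> (UNIV :: real set) \<lesssim> j ` ?S"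
      using reals eq lepoll_trans lepoll_trans2 by blast
    then have "j ` ?S \<prec> (UNIV :: real set)"
      by (meson UNIV_I lepoll_iff_leqpoll eqpoll_imp_lepoll eqpoll_sym subset_UNIV subset_imp_lepoll)
    then have "\<not> (UNIV :: nat set) \<prec> j ` ?S"
      using assms by (auto simp: continuum_hypothesis_def)
    then have "countable (j ` ?S)"
      by (metis countable_eqpoll countable_finite countableI_type infinite_le_lepoll lepoll_iff_leqpoll eqpoll_sym)
    then show ?thesis
      using eq countable_eqpoll eqpoll_sym by blast
  qed
  ultimately show ?thesis using that by blast
qed

section \<open>Controlled functions and the construction of large pairs\<close>

text \<open>The slack \<open>C\<close> is what allows a group element to absorb finitely many values of a new
  generator.\<close>

definition controlled :: "(nat \<Rightarrow> nat) \<times> (nat \<Rightarrow> int) \<Rightarrow> (nat \<Rightarrow> int) \<Rightarrow> bool" where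
  "controlled q g \<longleftrightarrow> (\<forall>C. \<exists>n. \<forall>i<fst q n. \<bar>g i\<bar> + C \<le> snd q n)"

text \<open>Diagonalization: stage \<open>n\<close> of the bound dominates the first
  \<open>n + 1\<close> members of an enumeration of \<open>A\<close> on the coordinates below
  \<open>h n\<close>, and the summand \<open>int n\<close> supplies arbitrarily large slack.\<close>

lemma ex_controlling_bound:
  fixes A :: "(nat \<Rightarrow> int) set"
  assumes "countable A"
  obtains p where "\<And>g. g \<in> A \<Longrightarrow> controlled (h, p) g"
proof
  let ?p = "\<lambda>n. int n + (\<Sum>k\<le>n. \<Sum>i<h n. \<bar>from_nat_into A k i\<bar>)"
  fix g assume "g \<in> A"
  then obtain k where k: "g = from_nat_into A k"
    using assms from_nat_into_surj by metis
  have "\<bar>g i\<bar> + C \<le> ?p (max k (nat C))" if "i < h (max k (nat C))" for i C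
  proof -
    let ?n = "max k (nat C)"
    have "\<bar>g i\<bar> \<le> (\<Sum>i<h ?n. \<bar>g i\<bar>)"
      by (rule member_le_sum) (use that in auto)
    also have "\<dots> \<le> (\<Sum>k\<le>?n. \<Sum>i<h ?n. \<bar>from_nat_into A k i\<bar>)"
      unfolding k by (rule member_le_sum[where f = "\<lambda>k. \<Sum>i<h ?n. \<bar>from_nat_into A k i\<bar>"])
        (auto intro: sum_nonneg)
    finally show ?thesis by linarith
  qed
  then show "controlled (h, ?p) g"
    unfolding controlled_def fst_conv snd_conv by blast
qed

text \<open>A Baire category argument: \<open>T k e z\<close> says that the first \<open>e\<close> values of \<open>z\<close> secure the
  \<open>k\<close>-th requirement.\<close>

lemma sequence_meeting_requirements:
  fixes ok :: "nat \<Rightarrow> 'c \<Rightarrow> bool" and T :: "nat \<Rightarrow> nat \<Rightarrow> (nat \<Rightarrow> 'c) \<Rightarrow> bool"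
  assumes ext: "\<And>k e z. \<forall>n<e. ok n (z n) \<Longrightarrow>
      \<exists>e' z'. e < e' \<and> (\<forall>n<e. z' n = z n) \<and> (\<forall>n<e'. ok n (z' n)) \<and> T k e' z'"
    and local: "\<And>k e z w. T k e z \<Longrightarrow> \<forall>n<e. z n = w n \<Longrightarrow> T k e w"
  obtains z where "\<And>n. ok n (z n)" "\<And>k. \<exists>e. T k e z"
proof -
  \<comment> \<open>A state is a length with a sequence of which only the values below that length
    count, so finite approximations are chosen one after another.\<close>
  have "\<exists>s. \<forall>k. (\<forall>n<fst (s k). ok n (snd (s k) n)) \<and> (fst (s k) < fst (s (Suc k)) \<and>
      (\<forall>n<fst (s k). snd (s (Suc k)) n = snd (s k) n) \<and> T k (fst (s (Suc k))) (snd (s (Suc k))))"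
  proof (rule dependent_nat_choice[where P = "\<lambda>k s. \<forall>n<fst s. ok n (snd s n)"
        and Q = "\<lambda>k s t. fst s < fst t \<and> (\<forall>n<fst s. snd t n = snd s n) \<and> T k (fst t) (snd t)"])
    show "\<exists>s. \<forall>n<fst s. ok n (snd s n)"
      by (rule exI[of _ "(0, undefined)"]) simp
  next
    fix s :: "nat \<times> (nat \<Rightarrow> 'c)" and k
    assume "\<forall>n<fst s. ok n (snd s n)"
    from ext[OF this, of k] obtain e' z' where "fst s < e'" "\<forall>n<fst s. z' n = snd s n"
        "\<forall>n<e'. ok n (z' n)" "T k e' z'"
      by blast
    then show "\<exists>t. (\<forall>n<fst t. ok n (snd t n)) \<and>
        (fst s < fst t \<and> (\<forall>n<fst s. snd t n = snd s n) \<and> T k (fst t) (snd t))"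
      by (intro exI[of _ "(e', z')"]) simp
  qed
  then obtain s where s: "\<And>k. \<forall>n<fst (s k). ok n (snd (s k) n)"
    "\<And>k. fst (s k) < fst (s (Suc k)) \<and> (\<forall>n<fst (s k). snd (s (Suc k)) n = snd (s k) n) \<and>
      T k (fst (s (Suc k))) (snd (s (Suc k)))"
    by blast
  define e where "e k = fst (s k)" for k
  define z where "z k = snd (s k)" for k
  have ok: "ok n (z k n)" if "n < e k" for k n
    using s(1)[of k] that by (simp add: e_def z_def)
  have less: "e k < e (Suc k)" and T: "T k (e (Suc k)) (z (Suc k))" for k
    using s(2)[of k] by (simp_all add: e_def z_def)
  have agree: "z (Suc k) n = z k n" if "n < e k" for k n
    using s(2)[of k] that by (simp add: e_def z_def)
  have mono: "strict_mono e"
    using less by (rule strict_mono_Suc_iff[THEN iffD2, rule_format])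
  have stable: "z l n = z k n" if "k \<le> l" "n < e k" for k l n
    using that(1)
  proof (induction l rule: dec_induct)
    case (step l)
    then show ?case
      using agree[of n l] that(2) strict_mono_less_eq[OF mono, of k l] by simp
  qed simp
  have bound: "n < e (Suc n)" for n
    using strict_mono_imp_increasing[OF mono, of "Suc n"] by linarith
  have diag: "z k n = z (Suc n) n" if "n < e k" for k n
    using stable[of k "Suc n" n] stable[of "Suc n" k n] that bound[of n]
    by (metis nle_le)
  show thesis
  \<comment> \<open>The limit is read off diagonally: lengths strictly increase, so coordinate
    \<open>n\<close> is final from stage \<open>Suc n\<close> on.\<close>
  proof (rule that[of "\<lambda>n. z (Suc n) n"])
    show "ok n (z (Suc n) n)" for n
      using ok bound by blast
    show "\<exists>e. T k e (\<lambda>n. z (Suc n) n)" for k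
      by (rule exI, rule local[OF T[of k]]) (use diag in simp)
  qed
qed

text \<open>To control \<open>g + a x + b y\<close>, extend \<open>(x, y)\<close> by large multiples of \<open>(b, - a)\<close>, along which
  \<open>a x + b y\<close> vanishes, until the bound is large enough to absorb the values of \<open>a x + b y\<close> chosen
  before.\<close>

lemma ex_large_pair_controlled:
  fixes A :: "(nat \<Rightarrow> int) set" and f :: "nat \<Rightarrow> nat"
  assumes "countable A" "countable P"
    and ctrl: "\<And>g q. g \<in> A \<Longrightarrow> q \<in> P \<Longrightarrow> controlled q g"
  obtains x y where "\<And>n. int (f n) < max \<bar>x n\<bar> \<bar>y n\<bar>"
    "\<And>g q a b. g \<in> A \<Longrightarrow> q \<in> P \<Longrightarrow> controlled q (\<lambda>i. g i + a * x i + b * y i)"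
\<comment> \<open>An empty \<open>A\<close> or \<open>P\<close> imposes no requirement and would
  leave \<open>from_nat_into\<close> nothing to enumerate.\<close>
proof (cases "A = {} \<or> P = {}")
  case True
  then show thesis
    by (intro that[of "\<lambda>n. int (f n) + 1" "\<lambda>n. 0"]) auto
next
  case False
  \<comment> \<open>One requirement for each combination and each slack. The pair
    \<open>(0, 0)\<close> is left out because multiples of \<open>(b, - a)\<close> would then not be
    large.\<close>
  define D where "D = A \<times> P \<times> {(a :: int, b :: int). (a, b) \<noteq> (0, 0)} \<times> (UNIV :: int set)"
  have "countable D"
    unfolding D_def using assms(1,2) by (intro countable_SIGMA) auto
  moreover have "D \<noteq> {}"
  proof -
    obtain g q where "g \<in> A" "q \<in> P" using False by blast
    then have "(g, q, (1, 0), 0) \<in> D" by (simp add: D_def)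
    then show ?thesis by blast
  qed
  moreover define d where "d = from_nat_into D"
  ultimately have d: "range d = D"
    by (simp add: range_from_nat_into)
  define T where "T = (\<lambda>k e (z :: nat \<Rightarrow> int \<times> int). case d k of (g, q, (a, b), C) \<Rightarrow>
    \<exists>n. fst q n \<le> e \<and> (\<forall>i<fst q n. \<bar>g i + a * fst (z i) + b * snd (z i)\<bar> + C \<le> snd q n))"
  obtain z where z: "\<And>n. int (f n) < max \<bar>fst (z n)\<bar> \<bar>snd (z n)\<bar>" and Tz: "\<And>k. \<exists>e. T k e z"
  proof (rule sequence_meeting_requirements[of "\<lambda>n v. int (f n) < max \<bar>fst v\<bar> \<bar>snd v\<bar>" T])
    fix k e and z :: "nat \<Rightarrow> int \<times> int"
    assume ok: "\<forall>n<e. int (f n) < max \<bar>fst (z n)\<bar> \<bar>snd (z n)\<bar>"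
    obtain g q ab C where "d k = (g, q, ab, C)" by (rule prod_cases4[of "d k"])
    moreover obtain a b where "ab = (a, b)" by (rule prod.exhaust[of ab])
    ultimately have dk: "d k = (g, q, (a, b), C)" by simp
    have "d k \<in> D" using d by blast
    then have mem: "g \<in> A" "q \<in> P" "(a, b) \<noteq> (0, 0)"
      by (auto simp: dk D_def)
    \<comment> \<open>Values of \<open>a x + b y\<close> chosen so far are at most \<open>S\<close>
      in absolute value and the new ones vanish, so slack \<open>S + C\<close> for \<open>g\<close>
      leaves slack \<open>C\<close> for the combination.\<close>
    define S where "S = (\<Sum>i<e. \<bar>a * fst (z i) + b * snd (z i)\<bar>)"
    obtain n where n: "\<And>i. i < fst q n \<Longrightarrow> \<bar>g i\<bar> + (S + C) \<le> snd q n"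
      using ctrl[OF mem(1,2)] unfolding controlled_def by blast
    \<comment> \<open>\<open>Suc e\<close> forces progress even when
      \<open>fst q n \<le> e\<close>.\<close>
    define e' where "e' = max (Suc e) (fst q n)"
    define z' where "z' i = (if i < e then z i else (b * (int (f i) + 1), - a * (int (f i) + 1)))" for i
    have big: "int (f i) < max \<bar>fst (z' i)\<bar> \<bar>snd (z' i)\<bar>" if "i < e'" for i
    proof (cases "i < e")
      case False
      define s where "s = int (f i) + 1"
      have large: "int (f i) < \<bar>c * s\<bar>" if "c \<noteq> 0" for c
      proof -
        have "1 * s \<le> \<bar>c\<bar> * s"
          by (rule mult_right_mono) (use that in \<open>auto simp: s_def\<close>)
        moreover have "\<bar>c * s\<bar> = \<bar>c\<bar> * s"
          by (simp add: s_def abs_mult)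
        moreover have "int (f i) < s"
          by (simp add: s_def)
        ultimately show ?thesis by linarith
      qed
      have "z' i = (b * s, - a * s)"
        using False by (simp add: z'_def s_def)
      then show ?thesis
        using large[of a] large[of b] mem(3) by (auto simp: less_max_iff_disj)
    qed (use ok in \<open>simp add: z'_def\<close>)
    have "\<bar>g i + a * fst (z' i) + b * snd (z' i)\<bar> + C \<le> snd q n" if i: "i < fst q n" for i
    proof -
      have "\<bar>a * fst (z' i) + b * snd (z' i)\<bar> \<le> S"
      proof (cases "i < e")
        case True
        then have "\<bar>a * fst (z i) + b * snd (z i)\<bar> \<le> S"
          unfolding S_def by (intro member_le_sum) auto
        then show ?thesis using True by (simp add: z'_def)
      qed (auto simp: z'_def S_def algebra_simps intro: sum_nonneg)
      then show ?thesis using n[OF i] by linarith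
    qed
    moreover have "fst q n \<le> e'"
      by (simp add: e'_def)
    ultimately have "T k e' z'"
      unfolding T_def dk by auto
    moreover have "e < e'" "\<forall>i<e. z' i = z i"
      by (auto simp: e'_def z'_def)
    ultimately show "\<exists>e' z'. e < e' \<and> (\<forall>n<e. z' n = z n) \<and>
        (\<forall>n<e'. int (f n) < max \<bar>fst (z' n)\<bar> \<bar>snd (z' n)\<bar>) \<and> T k e' z'"
      using big by blast
  next
    fix k e and z w :: "nat \<Rightarrow> int \<times> int"
    assume "T k e z" "\<forall>n<e. z n = w n"
    then show "T k e w"
      unfolding T_def by (fastforce split: prod.splits)
  qed blast
  show thesis
  proof (rule that[of "\<lambda>i. fst (z i)" "\<lambda>i. snd (z i)"])
    fix g q and a b :: int assume mem: "g \<in> A" "q \<in> P"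
    show "controlled q (\<lambda>i. g i + a * fst (z i) + b * snd (z i))"
    \<comment> \<open>The zero combination leaves \<open>g\<close> alone, which is controlled by
      hypothesis.\<close>
    proof (cases "(a, b) = (0, 0)")
      case False
      have "\<exists>n. \<forall>i<fst q n. \<bar>g i + a * fst (z i) + b * snd (z i)\<bar> + C \<le> snd q n" for C
      proof -
        have "(g, q, (a, b), C) \<in> range d"
          unfolding d using mem False by (simp add: D_def)
        then obtain k where "d k = (g, q, (a, b), C)" by force
        then show ?thesis using Tz[of k] by (auto simp: T_def)
      qed
      then show ?thesis by (simp add: controlled_def)
    qed (use ctrl[OF mem] in simp)
  qed (rule z)
qed

section \<open>Extending countable subgroups\<close>

lemma subgroup_baer_specker_iff:
  "subgroup A baer_specker \<longleftrightarrow> (\<lambda>i. 0) \<in> A \<and> (\<forall>g\<in>A. \<forall>h\<in>A. (\<lambda>i. g i - h i) \<in> A)" (is "_ \<longleftrightarrow> ?R")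
proof
  assume A: "subgroup A baer_specker"
  show ?R
    using subgroup.one_closed[OF A] subgroup.m_closed[OF A _ subgroup.m_inv_closed[OF A]]
    by (auto simp: inv_baer_specker) (simp_all add: baer_specker_def)
next
  assume R: ?R
  have neg: "(\<lambda>i. - h i) \<in> A" if "h \<in> A" for h
    using R that by (metis (no_types, lifting) diff_0 ext)
  have "(\<lambda>i. g i + h i) \<in> A" if "g \<in> A" "h \<in> A" for g h
  proof -
    have "(\<lambda>i. g i - - h i) \<in> A" using bspec[OF bspec[OF conjunct2[OF R] that(1)] neg[OF that(2)]] .
    then show ?thesis by simp
  qed
  then show "subgroup A baer_specker"
    using R neg by unfold_locales (auto simp: inv_baer_specker, auto simp: baer_specker_def)
qed

text \<open>The order of choices matters: \<open>p\<close> is taken from the old group and joins the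
  bounds, and only then is the pair chosen, so that its combinations with elements of
  \<open>A\<close> obey \<open>p\<close> as well as all earlier bounds.\<close>

lemma countable_group_extension:
  assumes A: "subgroup A baer_specker" "countable A" and P: "countable P"
    and ctrl: "\<And>g q. g \<in> A \<Longrightarrow> q \<in> P \<Longrightarrow> controlled q g"
  obtains B p x y where "subgroup B baer_specker" "countable B" "A \<subseteq> B"
    "\<And>g q. g \<in> B \<Longrightarrow> q \<in> insert (h, p) P \<Longrightarrow> controlled q g"
    "x \<in> B" "y \<in> B" "\<And>n. int (h n) < max \<bar>x n\<bar> \<bar>y n\<bar>"
proof -
  obtain p where p: "\<And>g. g \<in> A \<Longrightarrow> controlled (h, p) g"
    using ex_controlling_bound[OF A(2)] by blast
  obtain x y where xy: "\<And>n. int (h n) < max \<bar>x n\<bar> \<bar>y n\<bar>"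
    and B_ctrl: "\<And>g q a b. g \<in> A \<Longrightarrow> q \<in> insert (h, p) P \<Longrightarrow>
      controlled q (\<lambda>i. g i + a * x i + b * y i)"
    by (rule ex_large_pair_controlled[OF A(2), of "insert (h, p) P" h]) (use p ctrl P in auto)
  define c where "c = (\<lambda>(g, a, b) i. g i + a * x i + b * (y i :: int))"
  \<comment> \<open>This is the group generated by \<open>A\<close>, \<open>x\<close> and
    \<open>y\<close>; the parametrization by triples gives countability and closure.\<close>
  define B where "B = c ` (A \<times> UNIV \<times> UNIV)"
  have c_mem: "c (g, a, b) \<in> B" if "g \<in> A" for g a b
    using that by (auto simp: B_def)
  have zero: "(\<lambda>i. 0) \<in> A" and diff: "\<And>g h. g \<in> A \<Longrightarrow> h \<in> A \<Longrightarrow> (\<lambda>i. g i - h i) \<in> A"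
    using A(1) by (auto simp: subgroup_baer_specker_iff)
  show thesis
  proof (rule that)
    show "subgroup B baer_specker"
      unfolding subgroup_baer_specker_iff
    proof (intro conjI ballI)
      show "(\<lambda>i. 0) \<in> B" using c_mem[OF zero, of 0 0] by (simp add: c_def)
      fix u v assume "u \<in> B" "v \<in> B"
      then obtain g a b g' a' b' where uv: "u = c (g, a, b)" "v = c (g', a', b')" "g \<in> A" "g' \<in> A"
        by (auto simp: B_def)
      have "(\<lambda>i. u i - v i) = c (\<lambda>i. g i - g' i, a - a', b - b')"
        by (simp add: uv c_def algebra_simps)
      then show "(\<lambda>i. u i - v i) \<in> B" using c_mem[OF diff[OF uv(3,4)]] by simp
    qed
    show "countable B" unfolding B_def using A(2) by simp
    show "A \<subseteq> B" using c_mem[of _ 0 0] by (auto simp: c_def)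
    show "x \<in> B" using c_mem[OF zero, of 1 0] by (simp add: c_def)
    show "y \<in> B" using c_mem[OF zero, of 0 1] by (simp add: c_def)
    show "controlled q g" if "g \<in> B" "q \<in> insert (h, p) P" for g q
    proof -
      obtain u a b where "u \<in> A" "g = c (u, a, b)" using \<open>g \<in> B\<close> by (auto simp: B_def)
      then show ?thesis using B_ctrl[OF _ that(2)] by (simp add: c_def)
    qed
  qed (rule xy)
qed

lemma subgroup_Union_chain:
  assumes "\<C> \<noteq> {}" "\<And>A. A \<in> \<C> \<Longrightarrow> subgroup A baer_specker"
    "\<And>A B. A \<in> \<C> \<Longrightarrow> B \<in> \<C> \<Longrightarrow> A \<subseteq> B \<or> B \<subseteq> A"
  shows "subgroup (\<Union>\<C>) baer_specker"
  unfolding subgroup_baer_specker_iff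
proof (intro conjI ballI)
  show "(\<lambda>i. 0) \<in> \<Union>\<C>" using assms(1,2) by (auto simp: subgroup_baer_specker_iff)
  fix g h assume "g \<in> \<Union>\<C>" "h \<in> \<Union>\<C>"
  then obtain A where "A \<in> \<C>" "g \<in> A" "h \<in> A" using assms(3) by blast
  then show "(\<lambda>i. g i - h i) \<in> \<Union>\<C>" using assms(2) by (auto simp: subgroup_baer_specker_iff)
qed

section \<open>The transfinite recursion\<close>

text \<open>Along the well-order, \<open>F a\<close> records the countable group reached after
  treating \<open>a\<close> and the bound fixed there. Each stage has countably many predecessors,
  so \<open>countable_group_extension\<close> applies; the union of all stages is
  \<open>G\<close>.\<close>

lemma ex_controlled_group_large_pairs:
  assumes "continuum_hypothesis"
  obtains G p where "subgroup G baer_specker"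
    "\<And>h g. g \<in> G \<Longrightarrow> controlled (h, p h) g"
    "\<And>f :: nat \<Rightarrow> nat. \<exists>x\<in>G. \<exists>y\<in>G. \<forall>n. int (f n) < max \<bar>x n\<bar> \<bar>y n\<bar>"
proof -
  obtain R :: "(nat \<Rightarrow> nat) rel" where R: "wf R" "trans R" "total R" "\<And>a. countable {b. (b, a) \<in> R}"
    using continuum_hypothesis_wf_order[OF assms] by blast
  have tri: "b = c \<or> (b, c) \<in> R \<or> (c, b) \<in> R" for b c
    using R(3) by (auto simp: total_on_def)
  \<comment> \<open>The inserted zero group covers the least \<open>a\<close>, which has no
    predecessors.\<close>
  define A where "A F a = \<Union>(insert {\<lambda>i. 0} ((\<lambda>b. fst (F b)) ` {b. (b, a) \<in> R}))"
    for F :: "(nat \<Rightarrow> nat) \<Rightarrow> (nat \<Rightarrow> int) set \<times> (nat \<Rightarrow> int)" and a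
  define Q where "Q F a = (\<lambda>b. (b, snd (F b))) ` {b. (b, a) \<in> R}"
    for F :: "(nat \<Rightarrow> nat) \<Rightarrow> (nat \<Rightarrow> int) set \<times> (nat \<Rightarrow> int)" and a
  define good where "good F a s \<longleftrightarrow> subgroup (fst s) baer_specker \<and> countable (fst s) \<and> A F a \<subseteq> fst s \<and>
      (\<forall>g\<in>fst s. \<forall>q\<in>insert (a, snd s) (Q F a). controlled q g) \<and>
      (\<exists>x\<in>fst s. \<exists>y\<in>fst s. \<forall>n. int (a n) < max \<bar>x n\<bar> \<bar>y n\<bar>)"
    for F :: "(nat \<Rightarrow> nat) \<Rightarrow> (nat \<Rightarrow> int) set \<times> (nat \<Rightarrow> int)" and a s
  have "\<exists>F. \<forall>a. good F a (F a)"
  proof (rule dependent_wf_choice[OF R(1)])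
    fix F F' :: "(nat \<Rightarrow> nat) \<Rightarrow> (nat \<Rightarrow> int) set \<times> (nat \<Rightarrow> int)" and a s
    assume "\<And>b. (b, a) \<in> R \<Longrightarrow> F b = F' b"
    then have "A F a = A F' a" "Q F a = Q F' a"
      by (auto simp: A_def Q_def)
    then show "good F a s = good F' a s"
      by (simp add: good_def)
  next
    fix a and F :: "(nat \<Rightarrow> nat) \<Rightarrow> (nat \<Rightarrow> int) set \<times> (nat \<Rightarrow> int)"
    assume IH: "\<And>b. (b, a) \<in> R \<Longrightarrow> good F b (F b)"
    have sub: "fst (F b) \<subseteq> fst (F c)" if "(b, c) \<in> R" "(c, a) \<in> R" for b c
      using IH[OF that(2)] that(1) by (auto simp: good_def A_def)
    have zero: "(\<lambda>i. 0) \<in> fst (F b)" if "(b, a) \<in> R" for b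
      using IH[OF that] by (auto simp: good_def A_def)
    have "subgroup (A F a) baer_specker"
      unfolding A_def
    proof (rule subgroup_Union_chain)
      show "subgroup B baer_specker"
        if "B \<in> insert {\<lambda>i. 0} ((\<lambda>b. fst (F b)) ` {b. (b, a) \<in> R})" for B
        using that IH by (auto simp: good_def subgroup_baer_specker_iff)
      fix B C assume BC: "B \<in> insert {\<lambda>i. 0} ((\<lambda>b. fst (F b)) ` {b. (b, a) \<in> R})"
        "C \<in> insert {\<lambda>i. 0} ((\<lambda>b. fst (F b)) ` {b. (b, a) \<in> R})"
      have "fst (F b) \<subseteq> fst (F c) \<or> fst (F c) \<subseteq> fst (F b)" if "(b, a) \<in> R" "(c, a) \<in> R" for b c
        using that sub tri[of b c] by blast
      then show "B \<subseteq> C \<or> C \<subseteq> B" using BC zero by auto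
    qed simp
    moreover have "countable (A F a)"
      unfolding A_def using R(4)[of a] IH by (auto simp: good_def)
    moreover have "countable (Q F a)"
      unfolding Q_def using R(4)[of a] by simp
    moreover have "controlled q g" if "g \<in> A F a" "q \<in> Q F a" for g q
    proof -
      obtain b where b: "(b, a) \<in> R" "q = (b, snd (F b))"
        using \<open>q \<in> Q F a\<close> by (auto simp: Q_def)
      \<comment> \<open>A nonzero \<open>g\<close> comes from some stage \<open>c\<close>. If
        \<open>c\<close> is not after \<open>b\<close>, the group at \<open>b\<close> contains
        \<open>g\<close>; otherwise stage \<open>c\<close> has preserved the bound of
        \<open>b\<close>.\<close>
      consider "g \<in> fst (F b)" | c where "(c, a) \<in> R" "(b, c) \<in> R" "g \<in> fst (F c)"
      proof (cases "g = (\<lambda>i. 0)")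
        case True
        then show ?thesis using that(1) zero b(1) by blast
      next
        case False
        then obtain c where c: "(c, a) \<in> R" "g \<in> fst (F c)"
          using \<open>g \<in> A F a\<close> by (auto simp: A_def)
        then show ?thesis
          using that sub[of c b] b(1) tri[of b c] by blast
      qed
      then show ?thesis
        using IH b by cases (auto simp: good_def Q_def)
    qed
    ultimately obtain B p x y where "subgroup B baer_specker" "countable B" "A F a \<subseteq> B"
      "\<And>g q. g \<in> B \<Longrightarrow> q \<in> insert (a, p) (Q F a) \<Longrightarrow> controlled q g"
      "x \<in> B" "y \<in> B" "\<And>n. int (a n) < max \<bar>x n\<bar> \<bar>y n\<bar>"
      using countable_group_extension[of "A F a" "Q F a" a] by blast
    then have "good F a (B, p)"
      unfolding good_def fst_conv snd_conv by blast
    then show "\<exists>s. good F a s" ..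
  qed
  then obtain F where F: "\<And>a. good F a (F a)" by blast
  have sub: "fst (F b) \<subseteq> fst (F c)" if "(b, c) \<in> R" for b c
    using F[of c] that by (auto simp: good_def A_def)
  have ctrl: "controlled (b, snd (F b)) g" if "g \<in> fst (F a)" for a b g
  proof -
    \<comment> \<open>If \<open>g\<close> is present by stage \<open>b\<close>, the new bound of
      \<open>b\<close> covers it; if its stage \<open>a\<close> comes later, that bound is among the
      old ones in \<open>Q F a\<close>.\<close>
    consider "a = b" | "(a, b) \<in> R" | "(b, a) \<in> R"
      using tri by blast
    then show ?thesis
    proof cases
      case 3
      then have "(b, snd (F b)) \<in> Q F a" by (auto simp: Q_def)
      then show ?thesis using F[of a] that by (auto simp: good_def)
    next
      case 2
      then have "g \<in> fst (F b)" using sub that by blast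
      then show ?thesis using F[of b] by (auto simp: good_def)
    qed (use F[of b] that in \<open>auto simp: good_def\<close>)
  qed
  show thesis
  proof (rule that)
    show "subgroup (\<Union>(range (\<lambda>a. fst (F a)))) baer_specker"
    proof (rule subgroup_Union_chain)
      fix B C assume "B \<in> range (\<lambda>a. fst (F a))" "C \<in> range (\<lambda>a. fst (F a))"
      then obtain b c where "B = fst (F b)" "C = fst (F c)" by blast
      then show "B \<subseteq> C \<or> C \<subseteq> B"
        using sub[of b c] sub[of c b] tri[of b c] by blast
    qed (use F in \<open>auto simp: good_def\<close>)
    show "controlled (h, snd (F h)) g" if "g \<in> \<Union>(range (\<lambda>a. fst (F a)))" for h g
      using that ctrl by blast
    show "\<exists>x\<in>\<Union>(range (\<lambda>a. fst (F a))). \<exists>y\<in>\<Union>(range (\<lambda>a. fst (F a))).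
        \<forall>n. int (f n) < max \<bar>x n\<bar> \<bar>y n\<bar>" for f :: "nat \<Rightarrow> nat"
      using F[of f] unfolding good_def by blast
  qed
qed

section \<open>Menger-boundedness of the group and of its square\<close>

text \<open>Basic open sets of the product restrict only finitely many coordinates, all below some
  \<open>m\<close>.\<close>

lemma unit_neighborhood_baer_specker_cylinder:
  assumes "unit_neighborhood (baer_specker\<lparr>carrier := G\<rparr>) (subtopology baer_specker_topology G) U"
  obtains m where "\<And>x. x \<in> G \<Longrightarrow> (\<And>i. i < m \<Longrightarrow> x i = 0) \<Longrightarrow> x \<in> U"
proof -
  obtain W where W: "openin baer_specker_topology W" "(\<lambda>i. 0) \<in> W" "W \<inter> G \<subseteq> U"
    using assms by (auto simp: unit_neighborhood_def openin_subtopology baer_specker_def)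
  then obtain V where V: "finite {i. V i \<noteq> (UNIV :: int set)}" "\<And>i. 0 \<in> V i" "Pi UNIV V \<subseteq> W"
    unfolding baer_specker_topology_def openin_product_topology_alt
    by (fastforce simp: PiE_UNIV_domain)
  obtain m where m: "\<And>i. V i \<noteq> UNIV \<Longrightarrow> i < m"
    using V(1) by (metis (mono_tags, lifting) finite_nat_set_iff_bounded mem_Collect_eq)
  show thesis
  proof (rule that)
    fix x :: "nat \<Rightarrow> int" assume x: "x \<in> G" "\<And>i. i < m \<Longrightarrow> x i = 0"
    have "x i \<in> V i" for i
      using m[of i] x(2)[of i] V(2)[of i] by (cases "V i = UNIV") auto
    then show "x \<in> U" using V(3) W(3) x(1) by auto
  qed
qed

text \<open>Modulo \<open>U n\<close>, only the first \<open>m n\<close> coordinates matter.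
  Elements bounded there by \<open>p m n\<close> have finitely many restrictions, and one
  representative of each goes into \<open>F n\<close>. The hypothesis for \<open>h = m\<close>
  places every element in some \<open>S n\<close>.\<close>

lemma menger_bounded_subgroup_baer_specker:
  fixes p :: "(nat \<Rightarrow> nat) \<Rightarrow> nat \<Rightarrow> int"
  assumes G: "subgroup G baer_specker"
    and bound: "\<And>h g. g \<in> G \<Longrightarrow> \<exists>n. \<forall>i<h n. \<bar>g i\<bar> \<le> p h n"
  shows "menger_bounded (baer_specker\<lparr>carrier := G\<rparr>) (subtopology baer_specker_topology G)"
  unfolding menger_bounded_def
proof (intro allI impI)
  let ?H = "baer_specker\<lparr>carrier := G\<rparr>"
  fix U :: "nat \<Rightarrow> (nat \<Rightarrow> int) set"
  assume U: "\<forall>n. unit_neighborhood ?H (subtopology baer_specker_topology G) (U n)"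
  have U_sub: "U n \<subseteq> G" for n
    using U by (auto simp: unit_neighborhood_def)
  have "\<exists>m. \<forall>x\<in>G. (\<forall>i<m. x i = 0) \<longrightarrow> x \<in> U n" for n
    by (rule unit_neighborhood_baer_specker_cylinder[OF U[rule_format, of n]]) blast
  then obtain m where m: "\<And>n x. x \<in> G \<Longrightarrow> (\<And>i. i < m n \<Longrightarrow> x i = 0) \<Longrightarrow> x \<in> U n"
    by metis
  define S where "S n = {g \<in> G. \<forall>i<m n. \<bar>g i\<bar> \<le> p m n}" for n
  define r where "r n g = restrict g {..<m n}" for n and g :: "nat \<Rightarrow> int"
  have "finite (r n ` S n)" for n
  proof (rule finite_subset)
    show "r n ` S n \<subseteq> (\<Pi>\<^sub>E i\<in>{..<m n}. {- p m n..p m n})"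
      by (rule image_subsetI) (force simp: r_def S_def abs_le_iff)
  qed (auto intro: finite_PiE)
  then have "\<exists>F\<subseteq>S n. finite F \<and> r n ` S n = r n ` F" for n
    by (rule finite_subset_image) simp
  then obtain F where F: "\<And>n. F n \<subseteq> S n" "\<And>n. finite (F n)" "\<And>n. r n ` S n = r n ` F n"
    by metis
  have "F n \<subseteq> G" for n
    using F(1)[of n] by (auto simp: S_def)
  moreover have "G = (\<Union>n. F n <#>\<^bsub>?H\<^esub> U n)"
  proof (intro equalityI subsetI)
    fix g assume g: "g \<in> G"
    then obtain n where n: "g \<in> S n"
      using bound[of g m] by (auto simp: S_def)
    then have "r n g \<in> r n ` F n"
      using F(3)[of n] by blast
    then obtain c where c: "c \<in> F n" "r n g = r n c" by blast
    have eq: "g i = c i" if "i < m n" for i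
      using fun_cong[OF c(2), of i] that by (simp add: r_def)
    have "(\<lambda>i. g i - c i) \<in> U n"
    proof (rule m)
      show "(\<lambda>i. g i - c i) \<in> G"
        using G g c(1) \<open>F n \<subseteq> G\<close> by (auto simp: subgroup_baer_specker_iff)
    qed (simp add: eq)
    moreover have "g = c \<otimes>\<^bsub>?H\<^esub> (\<lambda>i. g i - c i)"
      by (simp add: baer_specker_def)
    ultimately show "g \<in> (\<Union>n. F n <#>\<^bsub>?H\<^esub> U n)"
      unfolding set_mult_def using c(1) by blast
  next
    fix g assume "g \<in> (\<Union>n. F n <#>\<^bsub>?H\<^esub> U n)"
    then show "g \<in> G"
      using \<open>\<And>n. F n \<subseteq> G\<close> U_sub subgroup.m_closed[OF G] by (fastforce simp: set_mult_def)
  qed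
  ultimately show "\<exists>F. (\<forall>n. finite (F n) \<and> F n \<subseteq> carrier ?H) \<and>
      carrier ?H = (\<Union>n. F n <#>\<^bsub>?H\<^esub> U n)"
    using F(2) by (intro exI[of _ F]) simp
qed

text \<open>Neighborhoods that fix just the \<open>n\<close>-th coordinates suffice: a cover by
  finitely many translates at each \<open>n\<close> would keep every pair below a single
  \<open>f\<close> at some \<open>n\<close>.\<close>

lemma not_menger_bounded_square_baer_specker:
  assumes G: "subgroup G baer_specker"
    and large: "\<And>f :: nat \<Rightarrow> nat. \<exists>x\<in>G. \<exists>y\<in>G. \<forall>n. int (f n) < max \<bar>x n\<bar> \<bar>y n\<bar>"
  shows "\<not> menger_bounded (baer_specker\<lparr>carrier := G\<rparr> \<times>\<times> baer_specker\<lparr>carrier := G\<rparr>)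
    (prod_topology (subtopology baer_specker_topology G) (subtopology baer_specker_topology G))"
    (is "\<not> menger_bounded ?H ?T")
proof
  assume menger: "menger_bounded ?H ?T"
  define Z where "Z n = {x \<in> G. x n = 0}" for n
  have "openin (subtopology baer_specker_topology G) (Z n)" for n
  proof -
    have "openin baer_specker_topology {x \<in> topspace baer_specker_topology. x n \<in> {0}}"
      unfolding baer_specker_topology_def
      by (rule openin_continuous_map_preimage[OF continuous_map_product_projection]) auto
    then show ?thesis
      by (auto simp: openin_subtopology Z_def baer_specker_topology_def)
  qed
  moreover have "(\<lambda>i. 0) \<in> G"
    using G by (simp add: subgroup_baer_specker_iff)
  ultimately have "unit_neighborhood ?H ?T (Z n \<times> Z n)" for n
    unfolding unit_neighborhood_def
    by (intro conjI exI[of _ "Z n \<times> Z n"])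
      (auto simp: openin_prod_Times_iff DirProd_def baer_specker_def Z_def)
  then obtain F where F: "\<And>n. finite (F n)" "carrier ?H = (\<Union>n. F n <#>\<^bsub>?H\<^esub> (Z n \<times> Z n))"
    using menger unfolding menger_bounded_def by meson
  \<comment> \<open>Summing over \<open>F n\<close> dominates both \<open>n\<close>-th coordinates
    of every pair in the \<open>n\<close>-th piece of the cover.\<close>
  define f where "f n = (\<Sum>(u, v)\<in>F n. nat \<bar>u n\<bar> + nat \<bar>v n\<bar>)" for n
  obtain x y where xy: "x \<in> G" "y \<in> G" "\<And>n. int (f n) < max \<bar>x n\<bar> \<bar>y n\<bar>"
    using large[of f] by blast
  have "(x, y) \<in> carrier ?H"
    using xy by (simp add: DirProd_def)
  then obtain n u v where "(u, v) \<in> F n" "x n = u n" "y n = v n"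
    unfolding F(2) by (auto simp: set_mult_def DirProd_def baer_specker_def Z_def)
  then have "nat \<bar>x n\<bar> + nat \<bar>y n\<bar> \<le> f n"
    unfolding f_def using member_le_sum[OF _ _ F(1), of "(u, v)" n "\<lambda>(u, v). nat \<bar>u n\<bar> + nat \<bar>v n\<bar>"]
    by simp
  then show False using xy(3)[of n] by linarith
qed

theorem theorem8:
  assumes "continuum_hypothesis"
  shows "\<exists>G. subgroup G baer_specker \<and>
    menger_bounded (baer_specker\<lparr>carrier := G\<rparr>) (subtopology baer_specker_topology G) \<and>
    \<not> menger_bounded
        (baer_specker\<lparr>carrier := G\<rparr> \<times>\<times> baer_specker\<lparr>carrier := G\<rparr>)
        (prod_topology (subtopology baer_specker_topology G) (subtopology baer_specker_topology G))"
proof -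
  obtain G p where G: "subgroup G baer_specker"
    and ctrl: "\<And>h g. g \<in> G \<Longrightarrow> controlled (h, p h) g"
    and large: "\<And>f :: nat \<Rightarrow> nat. \<exists>x\<in>G. \<exists>y\<in>G. \<forall>n. int (f n) < max \<bar>x n\<bar> \<bar>y n\<bar>"
    using ex_controlled_group_large_pairs[OF assms] by blast
  have "\<exists>n. \<forall>i<h n. \<bar>g i\<bar> \<le> p h n" if "g \<in> G" for h g
    \<comment> \<open>The slack served the recursion; here \<open>C = 0\<close> is enough.\<close>
    using ctrl[OF that, of h, unfolded controlled_def, THEN spec, of 0] by simp
  then show ?thesis
    using menger_bounded_subgroup_baer_specker[OF G]
      not_menger_bounded_square_baer_specker[OF G large] G by blast
qed

end
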